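(* Let $X$ and $Y$ be independent, identically distributed, non-negative, absolutely continuous random variables. Then $X$ and $\max\left\{\frac{X}{Y},\frac{Y}{X}\right\}$ have the same distribution if and only if the distribution of $X$ belongs to the family $\mathcal{P}$.
   Context: $\mathcal{P}$ denotes the family of Pareto distributions with distribution functions $F(x)=1-x^{-\alpha}$, $x\ge 1$, where $\alpha>0$ ranges over all positive reals. *)

theory Defs
  imports "HOL-Probability.Probability"
begin

definition pareto_cdf :: "real \<Rightarrow> real \<Rightarrow> real" where
  "pareto_cdf \<alpha> x = (if 1 \<le> x then 1 - x powr (- \<alpha>) else 0)"

definition pareto_family :: "real measure set" where
  "pareto_family = {D. \<exists>\<alpha>>0. cdf D = pareto_cdf \<alpha>}"

end

(*
  Put U = ln X and V = ln Y. The condition says that |U - V| and U have the same law. Then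
  L(s) = E exp(-s U) satisfies (2 L(s) - 1) (2 L(-s) - 1) = 1 wherever both factors are defined,
  because U - V is symmetric. Let L(c) = 1/2. Comparing exponential moments in
  min (U - V) n >= min U n - V bounds E exp(r U) for r < c, so L is holomorphic on Re s > -c.
  The only zero of 2 L - 1 in Re s >= 0 is c, and it is simple. Hence
  K(s) = (2 L(s) - 1) (c + s) / (c - s) is zero-free there, and the relation K(s) K(-s) = 1
  continues it to an entire function. By the Riemann-Lebesgue lemma (this uses absolute
  continuity) K tends to 1 at infinity, so K = 1 by Liouville's theorem, L(s) = c / (c + s), and
  U is exponential. Conversely, for a Pareto law
  P(X > z Y) = z powr -a * P(X > Y) = z powr -a / 2 for z >= 1.
*)
theory Submission
  imports Defs "HOL-Complex_Analysis.Complex_Analysis"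
begin

text \<open>The equation alone does not force an exponential law: U uniform on {0, 1} satisfies it
  too. Absolute continuity therefore has to enter in an essential way. In the forward direction it
  does so three times: there is no atom at 0, so L decreases strictly to 0; no lattice carries the
  law, so 2 L - 1 has no second zero on the line Re s = c; and L vanishes at infinity. Liouville's
  theorem asks for this last limit in every direction, so Riemann-Lebesgue is proved on the whole
  closed right half-plane and not only on its boundary. The reflection relation pairs s with -s, and
  for L known only on Re s >= 0 such pairs meet only on the imaginary axis. Exponential moments
  widen the axis to the strip |Re s| < c, where the two halves of the entire function overlap in an
  open set and can be glued. The factor B(s) = (c + s) / (c - s) removes the zero at c and keeps the
  rest intact: B(s) B(-s) = 1, and B tends to -1 at infinity, just as 2 L - 1 does.\<close>

section \<open>The Riemann--Lebesgue lemma on a half-plane\<close>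

text \<open>The indicator keeps the integrand below \<open>norm (f x)\<close> whenever
  \<open>0 \<le> Re s\<close>, whatever the support of \<open>f\<close>. The transform thus makes
  sense for every integrable \<open>f\<close>, and induction over integrable functions can be
  applied to it.\<close>

definition halfline_laplace :: "(real \<Rightarrow> real) \<Rightarrow> complex \<Rightarrow> complex" where
  "halfline_laplace f s = (LINT x|lborel. (indicator {0..} x * f x) *\<^sub>R exp (- (s * of_real x)))"

abbreviation at_infinity_right :: "complex filter" where
  "at_infinity_right \<equiv> inf at_infinity (principal {s. 0 \<le> Re s})"

lemma eventually_at_infinity_right:
  "eventually P at_infinity_right \<longleftrightarrow> (\<exists>b. \<forall>s. b \<le> norm s \<longrightarrow> 0 \<le> Re s \<longrightarrow> P s)"
  by (simp add: eventually_inf_principal eventually_at_infinity)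

lemma norm_exp_halfline:
  assumes "0 \<le> Re s" "0 \<le> x"
  shows "norm (exp (- (s * of_real x))) \<le> 1"
  using assms by simp

lemma halfline_laplace_integrable:
  assumes "integrable lborel f" "0 \<le> Re s"
  shows "integrable lborel (\<lambda>x. (indicator {0..} x * f x) *\<^sub>R exp (- (s * of_real x)))"
proof (rule Bochner_Integration.integrable_bound[OF assms(1)])
  show "(\<lambda>x. (indicator {0..} x * f x) *\<^sub>R exp (- (s * of_real x))) \<in> borel_measurable lborel"
    using borel_measurable_integrable[OF assms(1)] by measurable
  show "AE x in lborel. norm ((indicator {0..} x * f x) *\<^sub>R exp (- (s * of_real x))) \<le> norm (f x)"
    using assms(2) by (intro AE_I2) (auto simp: indicator_def abs_mult mult_left_le)
qed

lemma halfline_laplace_add: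
  assumes "integrable lborel f" "integrable lborel g" "0 \<le> Re s"
  shows "halfline_laplace (\<lambda>x. f x + g x) s = halfline_laplace f s + halfline_laplace g s"
  unfolding halfline_laplace_def
  using Bochner_Integration.integral_add[OF halfline_laplace_integrable[OF assms(1,3)]
      halfline_laplace_integrable[OF assms(2,3)]]
  by (simp add: algebra_simps)

lemma halfline_laplace_cmult:
  "halfline_laplace (\<lambda>x. c * f x) s = c *\<^sub>R halfline_laplace f s"
  unfolding halfline_laplace_def
  by (subst integral_scaleR_right[symmetric]) (auto simp: algebra_simps)

lemma halfline_laplace_diff_le:
  assumes f: "integrable lborel f" and g: "integrable lborel g" and s: "0 \<le> Re s"
  shows "norm (halfline_laplace f s - halfline_laplace g s) \<le> (LINT x|lborel. norm (f x - g x))"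
proof -
  have "halfline_laplace f s - halfline_laplace g s
      = (LINT x|lborel. (indicator {0..} x * f x) *\<^sub>R exp (- (s * of_real x))
          - (indicator {0..} x * g x) *\<^sub>R exp (- (s * of_real x)))"
    unfolding halfline_laplace_def
    by (rule Bochner_Integration.integral_diff[symmetric])
      (intro halfline_laplace_integrable f g s)+
  also have "norm \<dots> \<le> (LINT x|lborel. norm (f x - g x))"
  proof (rule Bochner_Integration.integral_norm_bound_integral)
    show "integrable lborel (\<lambda>x. (indicator {0..} x * f x) *\<^sub>R exp (- (s * of_real x))
          - (indicator {0..} x * g x) *\<^sub>R exp (- (s * of_real x)))"
      by (intro Bochner_Integration.integrable_diff halfline_laplace_integrable f g s)
    show "integrable lborel (\<lambda>x. norm (f x - g x))"
      using f g by simp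
    show "norm ((indicator {0..} x * f x) *\<^sub>R exp (- (s * of_real x))
          - (indicator {0..} x * g x) *\<^sub>R exp (- (s * of_real x))) \<le> norm (f x - g x)" for x
    proof (cases "0 \<le> x")
      case True
      have "norm ((f x - g x) *\<^sub>R exp (- (s * of_real x))) \<le> norm (f x - g x)"
        using norm_exp_halfline[OF s True] by (simp add: mult_left_le)
      then show ?thesis
        using True by (simp add: scaleR_diff_left)
    qed simp
  qed
  finally show ?thesis .
qed

definition laplace_vanishes :: "(real \<Rightarrow> real) \<Rightarrow> bool" where
  "laplace_vanishes f \<longleftrightarrow> (halfline_laplace f \<longlongrightarrow> 0) at_infinity_right"

lemma laplace_vanishes_add:
  assumes "integrable lborel f" "integrable lborel g" "laplace_vanishes f" "laplace_vanishes g"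
  shows "laplace_vanishes (\<lambda>x. f x + g x)"
proof -
  have "((\<lambda>s. halfline_laplace f s + halfline_laplace g s) \<longlongrightarrow> 0) at_infinity_right"
    using tendsto_add[OF assms(3,4)[unfolded laplace_vanishes_def]] by simp
  then show ?thesis
    unfolding laplace_vanishes_def
    by (rule Lim_transform_eventually)
      (auto simp: eventually_inf_principal halfline_laplace_add[OF assms(1,2)])
qed

lemma laplace_vanishes_cmult:
  assumes "laplace_vanishes f"
  shows "laplace_vanishes (\<lambda>x. c * f x)"
proof -
  have "halfline_laplace (\<lambda>x. c * f x) = (\<lambda>s. c *\<^sub>R halfline_laplace f s)"
    by (rule ext) (rule halfline_laplace_cmult)
  then show ?thesis
    using tendsto_scaleR[OF tendsto_const[of c] assms[unfolded laplace_vanishes_def]]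
    by (simp add: laplace_vanishes_def)
qed

text \<open>The kernel has modulus at most 1 on the half-plane, so an error that is small in L1
  moves the transform by a small amount uniformly in \<open>s\<close>. Decay at infinity hence
  survives L1 limits, and domination by \<open>w\<close> upgrades the pointwise limit to one in
  L1.\<close>

lemma laplace_vanishes_dominated_limit:
  assumes g: "\<And>n. integrable lborel (g n)" "\<And>n. laplace_vanishes (g n)"
    and lim: "\<And>x. (\<lambda>n. g n x) \<longlonglongrightarrow> f x"
    and w: "integrable lborel w" "\<And>n x. norm (g n x) \<le> w x"
  shows "laplace_vanishes f"
proof -
  have [measurable]: "g n \<in> borel_measurable lborel" for n
    using g(1) by (rule borel_measurable_integrable)
  have mf [measurable]: "f \<in> borel_measurable lborel"
    by (rule borel_measurable_LIMSEQ_real[OF lim]) auto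
  have f: "integrable lborel f"
    by (rule integrable_dominated_convergence[of f lborel g w]) (use lim w in auto)
  have conv: "(\<lambda>n. LINT x|lborel. norm (f x - g n x)) \<longlonglongrightarrow> (LINT x|(lborel :: real measure). 0)"
  proof (rule Bochner_Integration.integral_dominated_convergence[where w = "\<lambda>x. norm (f x) + w x"])
    show "integrable lborel (\<lambda>x. norm (f x) + w x)"
      using f w by simp
    have "(\<lambda>n. norm (f x - g n x)) \<longlonglongrightarrow> norm (f x - f x)" for x
      by (intro tendsto_intros lim)
    then show "AE x in lborel. (\<lambda>n. norm (f x - g n x)) \<longlonglongrightarrow> 0"
      by simp
    show "AE x in lborel. norm (norm (f x - g n x)) \<le> norm (f x) + w x" for n
    proof (intro AE_I2)
      fix x
      show "norm (norm (f x - g n x)) \<le> norm (f x) + w x"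
        using w(2)[of n x] norm_triangle_ineq4[of "f x" "g n x"] by simp
    qed
  qed auto
  show ?thesis
    unfolding laplace_vanishes_def
  proof (rule tendstoI)
    fix e :: real assume "0 < e"
    then have "eventually (\<lambda>n. (LINT x|lborel. norm (f x - g n x)) < e / 2) sequentially"
      using order_tendstoD(2)[OF conv, of "e/2"] by simp
    then obtain n where n: "(LINT x|lborel. norm (f x - g n x)) < e / 2"
      by (auto simp: eventually_sequentially)
    have "eventually (\<lambda>s. norm (halfline_laplace (g n) s) < e / 2) at_infinity_right"
      using tendstoD[OF g(2)[of n, unfolded laplace_vanishes_def], of "e/2"] \<open>0 < e\<close> by simp
    moreover have "eventually (\<lambda>s. 0 \<le> Re s) at_infinity_right"
      by (simp add: eventually_inf_principal)
    ultimately show "eventually (\<lambda>s. dist (halfline_laplace f s) 0 < e) at_infinity_right"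
    proof eventually_elim
      case (elim s)
      have "norm (halfline_laplace f s) \<le> norm (halfline_laplace f s - halfline_laplace (g n) s)
          + norm (halfline_laplace (g n) s)"
        by norm
      with halfline_laplace_diff_le[OF f g(1)[of n] elim(2)] n elim(1) show ?case
        by simp
    qed
  qed
qed

section \<open>Decay for intervals, Borel sets and integrable functions\<close>

lemma integral_exp_Icc:
  fixes s :: complex
  assumes "s \<noteq> 0" "a \<le> b"
  shows "(LINT x|lborel. indicator {a..b} x *\<^sub>R exp (- (s * of_real x)))
    = (exp (- (s * of_real a)) - exp (- (s * of_real b))) / s"
proof -
  have "(LINT x|lborel. indicator {a..b} x *\<^sub>R exp (- (s * of_real x)))
    = - exp (- (s * of_real b)) / s - (- exp (- (s * of_real a)) / s)"
  proof (rule integral_FTC_Icc[OF assms(2)])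
    show "((\<lambda>x. - exp (- (s * of_real x)) / s) has_vector_derivative exp (- (s * of_real x)))
        (at x within {a..b})" for x
    proof -
      have "((\<lambda>z. - exp (- (s * z)) / s) has_field_derivative exp (- (s * of_real x))) (at (of_real x))"
        using assms(1) by (auto intro!: derivative_eq_intros)
      from has_vector_derivative_real_field[OF this] show ?thesis .
    qed
    show "continuous_on {a..b} (\<lambda>x. exp (- (s * of_real x)))"
      by (intro continuous_intros)
  qed
  then show ?thesis
    using assms(1) by (simp add: field_simps)
qed

text \<open>Integrating the exponential gains a factor \<open>1 / s\<close>, and the two boundary
  values have modulus at most 1; hence the bound \<open>2 / norm s\<close>.\<close>

lemma laplace_vanishes_Icc: "laplace_vanishes (indicator {a..b})"
proof -
  have bound: "norm (halfline_laplace (indicator {a..b}) s) \<le> 2 / norm s"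
    if "s \<noteq> 0" "0 \<le> Re s" for s
  proof (cases "max 0 a \<le> b")
    case True
    have "halfline_laplace (indicator {a..b}) s
        = (LINT x|lborel. indicator {max 0 a..b} x *\<^sub>R exp (- (s * of_real x)))"
      unfolding halfline_laplace_def
      by (intro Bochner_Integration.integral_cong) (auto simp: indicator_def)
    also have "\<dots> = (exp (- (s * of_real (max 0 a))) - exp (- (s * of_real b))) / s"
      by (rule integral_exp_Icc[OF that(1) True])
    finally have "norm (halfline_laplace (indicator {a..b}) s)
        = norm (exp (- (s * of_real (max 0 a))) - exp (- (s * of_real b))) / norm s"
      by (simp add: norm_divide)
    also have "\<dots> \<le> 2 / norm s"
    proof (rule divide_right_mono)
      have "norm (exp (- (s * of_real (max 0 a)))) \<le> 1" "norm (exp (- (s * of_real b))) \<le> 1"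
        using norm_exp_halfline[OF that(2)] True by auto
      then show "norm (exp (- (s * of_real (max 0 a))) - exp (- (s * of_real b))) \<le> 2"
        using norm_triangle_ineq4[of "exp (- (s * of_real (max 0 a)))" "exp (- (s * of_real b))"]
        by linarith
    qed simp
    finally show ?thesis .
  next
    case False
    then have "(\<lambda>x. (indicator {0..} x * indicator {a..b} x) *\<^sub>R exp (- (s * of_real x))) = (\<lambda>x. 0)"
      by (auto simp: indicator_def fun_eq_iff)
    then show ?thesis
      by (simp add: halfline_laplace_def)
  qed
  have "((\<lambda>s::complex. 2 / norm s) \<longlongrightarrow> 0) at_infinity"
    by (intro tendsto_divide_0[OF tendsto_const] filterlim_at_top_imp_at_infinity
        filterlim_norm_at_top)
  then have "((\<lambda>s::complex. 2 / norm s) \<longlongrightarrow> 0) at_infinity_right"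
    by (rule tendsto_mono[rotated]) simp
  then show ?thesis
    unfolding laplace_vanishes_def
    by (rule Lim_null_comparison[rotated])
      (auto simp: eventually_at_infinity_right intro!: exI[of _ 1] bound)
qed

text \<open>A Dynkin-system argument started from the half-lines \<open>{..c}\<close>. The fixed
  window \<open>{a..b}\<close> keeps all indicators integrable: complements become differences from
  the indicator of the window, and that indicator dominates the partial sums of a disjoint
  union.\<close>

lemma laplace_vanishes_borel_Icc:
  assumes "A \<in> sets borel"
  shows "laplace_vanishes (indicator (A \<inter> {a..b::real}))"
proof -
  have sb: "sigma_sets UNIV (range (\<lambda>a::real. {..a})) = sets borel"
    by (subst borel_eq_atMost) simp
  have "Int_stable (range (\<lambda>a::real. {..a}))" "range (\<lambda>a::real. {..a}) \<subseteq> Pow UNIV"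
    by (auto simp: Int_stable_def)
  moreover have "A \<in> sigma_sets UNIV (range (\<lambda>a::real. {..a}))"
    using assms sb by simp
  ultimately show ?thesis
  proof (induction rule: sigma_sets_induct_disjoint[where \<Omega> = UNIV and G = "range (\<lambda>a::real. {..a})"])
    case (basic A)
    then obtain c where "A = {..c}" by auto
    then have "A \<inter> {a..b} = {a..min b c}" by auto
    then show ?case by (simp add: laplace_vanishes_Icc)
  next
    case empty
    then show ?case by (simp add: laplace_vanishes_def halfline_laplace_def[abs_def])
  next
    case (compl A)
    then have [measurable]: "A \<in> sets borel" using sb by simp
    have int: "integrable lborel (indicat_real (A \<inter> {a..b}))"
      by (intro integrable_real_indicator)
        (auto intro: le_less_trans[OF emeasure_mono[of "A \<inter> {a..b}" "{a..b}" lborel]]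
          simp: emeasure_lborel_Icc_eq)
    have int': "integrable lborel (indicat_real {a..b})"
      by (intro integrable_real_indicator) (auto simp: emeasure_lborel_Icc_eq)
    have "laplace_vanishes (\<lambda>x. indicat_real {a..b} x + (-1) * indicat_real (A \<inter> {a..b}) x)"
      using int int' compl by (intro laplace_vanishes_add laplace_vanishes_cmult laplace_vanishes_Icc) auto
    also have "(\<lambda>x. indicat_real {a..b} x + (-1) * indicat_real (A \<inter> {a..b}) x)
        = indicator ((UNIV - A) \<inter> {a..b})"
      by (auto simp: fun_eq_iff indicator_def)
    finally show ?case .
  next
    case (union A)
    have [measurable]: "A i \<in> sets borel" for i
      using union sb by auto
    have int': "integrable lborel (indicat_real {a..b})"
      by (intro integrable_real_indicator) (auto simp: emeasure_lborel_Icc_eq)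
    have int: "integrable lborel (indicat_real (A i \<inter> {a..b}))" for i
      by (intro integrable_real_indicator)
        (auto intro: le_less_trans[OF emeasure_mono[of "A i \<inter> {a..b}" "{a..b}" lborel]]
          simp: emeasure_lborel_Icc_eq)
    have int2: "integrable lborel (\<lambda>x. \<Sum>i<n. indicat_real (A i \<inter> {a..b}) x)" for n
      using int by simp
    have part: "laplace_vanishes (\<lambda>x. \<Sum>i<n. indicat_real (A i \<inter> {a..b}) x)" for n
    proof (induction n)
      case 0
      then show ?case by (simp add: laplace_vanishes_def halfline_laplace_def[abs_def])
    next
      case (Suc n)
      then show ?case
        using laplace_vanishes_add[OF int2 int Suc union(3)] by simp
    qed
    have disj: "disjoint_family (\<lambda>i. A i \<inter> {a..b})"
      using union(1) by (auto simp: disjoint_family_on_def)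
    have sum_eq: "(\<Sum>i<n. indicat_real (A i \<inter> {a..b}) x) = indicator (\<Union>i<n. A i \<inter> {a..b}) x" for n x
      by (rule indicator_UN_disjoint[symmetric])
        (use disj in \<open>auto simp: disjoint_family_on_def\<close>)
    show ?case
    proof (rule laplace_vanishes_dominated_limit[OF int2 part _ int'])
      show "norm (\<Sum>i<n. indicat_real (A i \<inter> {a..b}) x) \<le> indicat_real {a..b} x" for n x
        unfolding sum_eq by (auto simp: indicator_def)
      show "(\<lambda>n. \<Sum>i<n. indicat_real (A i \<inter> {a..b}) x)
          \<longlonglongrightarrow> indicat_real (\<Union> (range A) \<inter> {a..b}) x" for x
        unfolding sum_eq
        using LIMSEQ_indicator_UN[of "\<lambda>i. A i \<inter> {a..b}" x] by simp
    qed
  qed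
qed

theorem Riemann_Lebesgue_halfplane:
  assumes "integrable lborel f"
  shows "laplace_vanishes f"
  using assms
proof (induction rule: integrable_induct)
  case (base A c)
  then have [measurable]: "A \<in> sets borel" by simp
  have "laplace_vanishes (indicator A)"
  proof (rule laplace_vanishes_dominated_limit[where
        g = "\<lambda>n. indicat_real (A \<inter> {- real n..real n})" and w = "indicat_real A"])
    show "integrable lborel (indicat_real A)"
      using base by (intro integrable_real_indicator) auto
    show "integrable lborel (indicat_real (A \<inter> {- real n..real n}))" for n
      using base by (intro integrable_real_indicator)
        (auto intro: le_less_trans[OF emeasure_mono[of "A \<inter> {- real n..real n}" A lborel]])
    show "laplace_vanishes (indicat_real (A \<inter> {- real n..real n}))" for n
      by (rule laplace_vanishes_borel_Icc) measurable
    show "norm (indicat_real (A \<inter> {- real n..real n}) x) \<le> indicat_real A x" for n x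
      by (auto simp: indicator_def)
    show "(\<lambda>n. indicat_real (A \<inter> {- real n..real n}) x) \<longlonglongrightarrow> indicat_real A x" for x
    proof (rule tendsto_eventually)
      obtain N where "\<bar>x\<bar> \<le> real N" using real_arch_simple by blast
      then show "eventually (\<lambda>n. indicat_real (A \<inter> {- real n..real n}) x = indicat_real A x) sequentially"
        by (intro eventually_sequentiallyI[of N]) (auto simp: indicator_def)
    qed
  qed
  from laplace_vanishes_cmult[OF this, of c] show ?case
    by (simp add: mult.commute)
next
  case (add f g)
  then show ?case by (intro laplace_vanishes_add)
next
  case (lim f s)
  show ?case
    \<comment> \<open>The factor 2 is the one in the domination that
      \<open>integrable_induct\<close> supplies for its approximating sequence.\<close>
    by (rule laplace_vanishes_dominated_limit[of s f "\<lambda>x. 2 * norm (f x)"])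
      (use lim in auto)
qed

section \<open>Laws invariant under the absolute difference of two copies\<close>

text \<open>The mean value inequality on a ball around 0. It serves to dominate the difference
  quotients of the complex Laplace transform.\<close>

lemma norm_exp_minus_one_le:
  fixes z :: complex
  shows "norm (exp z - 1) \<le> norm z * exp (norm z)"
proof -
  have "norm (exp z - exp 0) \<le> exp (norm z) * norm (z - 0)"
  proof (rule field_differentiable_bound[of "cball 0 (norm z)"])
    show "(exp has_field_derivative exp w) (at w within cball 0 (norm z))" for w :: complex
      by (auto intro!: derivative_eq_intros)
    show "norm (exp w) \<le> exp (norm z)" if "w \<in> cball 0 (norm z)" for w :: complex
      using norm_exp[of w] that by (auto intro: order_trans)
  qed auto
  then show ?thesis
    by (simp add: mult.commute)
qed

section \<open>Two independent copies of a real random variable\<close>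

locale iid_pair = prob_space M for M :: "'a measure" +
  fixes U V :: "'a \<Rightarrow> real"
  assumes indep: "indep_var borel U borel V"
    and eq_distr: "distr M borel V = distr M borel U"
begin

lemma measurable_U [measurable]: "U \<in> borel_measurable M"
  using indep by (rule indep_var_rv1)

lemma measurable_V [measurable]: "V \<in> borel_measurable M"
  using indep by (rule indep_var_rv2)

lemma AE_V:
  assumes "AE w in M. P (U w)" and [measurable]: "Measurable.pred borel P"
  shows "AE w in M. P (V w)"
proof -
  have "AE x in distr M borel U. P x"
    using assms(1) by (subst AE_distr_iff) auto
  then have "AE x in distr M borel V. P x"
    by (simp only: eq_distr)
  then show ?thesis
    by (subst (asm) AE_distr_iff) auto
qed

lemma AE_notin_null:
  assumes "absolutely_continuous lborel (distr M borel U)" and N: "N \<in> null_sets lborel"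
  shows "AE w in M. U w \<notin> N"
proof -
  have "N \<in> null_sets (distr M borel U)"
    using assms by (auto simp: absolutely_continuous_def)
  then have "AE x in distr M borel U. x \<notin> N"
    by (rule AE_not_in)
  moreover have [measurable]: "N \<in> sets borel"
    using N by auto
  ultimately show ?thesis
    by (subst (asm) AE_distr_iff) auto
qed

lemma integral_V:
  fixes f :: "real \<Rightarrow> 'b::{banach, second_countable_topology}"
  assumes [measurable]: "f \<in> borel_measurable borel"
  shows "(LINT w|M. f (V w)) = (LINT w|M. f (U w))"
proof -
  have "(LINT x|distr M borel V. f x) = (LINT x|distr M borel U. f x)"
    by (simp only: eq_distr)
  then show ?thesis
    by (simp add: integral_distr)
qed

lemma integrable_V_iff:
  fixes f :: "real \<Rightarrow> 'b::{banach, second_countable_topology}"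
  assumes [measurable]: "f \<in> borel_measurable borel"
  shows "integrable M (\<lambda>w. f (V w)) \<longleftrightarrow> integrable M (\<lambda>w. f (U w))"
proof -
  have "integrable (distr M borel V) f \<longleftrightarrow> integrable (distr M borel U) f"
    by (simp only: eq_distr)
  then show ?thesis
    by (simp add: integrable_distr_eq)
qed

lemma joint_distr:
  "distr M (borel \<Otimes>\<^sub>M borel) (\<lambda>w. (U w, V w)) = distr M borel U \<Otimes>\<^sub>M distr M borel U"
  using indep unfolding indep_var_distribution_eq eq_distr by simp

text \<open>By independence the joint law is the product of a measure with itself, which exchanging
  the coordinates preserves. This is the source of the symmetry of \<open>U - V\<close>.\<close>

lemma distr_swap:
  "distr M (borel \<Otimes>\<^sub>M borel) (\<lambda>w. (V w, U w)) = distr M (borel \<Otimes>\<^sub>M borel) (\<lambda>w. (U w, V w))"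
proof -
  interpret D: prob_space "distr M borel U"
    by (rule prob_space_distr) simp
  interpret DD: pair_prob_space "distr M borel U" "distr M borel U" ..
  let ?D = "distr M borel U"
  have "distr M (borel \<Otimes>\<^sub>M borel) (\<lambda>w. (V w, U w))
      = distr (distr M (borel \<Otimes>\<^sub>M borel) (\<lambda>w. (U w, V w))) (borel \<Otimes>\<^sub>M borel) (\<lambda>(x, y). (y, x))"
    by (subst distr_distr) (auto simp: comp_def)
  also have "\<dots> = distr (?D \<Otimes>\<^sub>M ?D) (?D \<Otimes>\<^sub>M ?D) (\<lambda>(x, y). (y, x))"
    unfolding joint_distr by (rule distr_cong) (auto intro!: sets_pair_measure_cong)
  also have "\<dots> = ?D \<Otimes>\<^sub>M ?D"
    by (rule DD.distr_pair_swap[symmetric])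
  finally show ?thesis
    by (simp only: joint_distr)
qed

lemma integral_diff_swap:
  fixes f :: "real \<Rightarrow> 'b::{banach, second_countable_topology}"
  assumes [measurable]: "f \<in> borel_measurable borel"
  shows "(LINT w|M. f (V w - U w)) = (LINT w|M. f (U w - V w))"
proof -
  have "(LINT p|distr M (borel \<Otimes>\<^sub>M borel) (\<lambda>w. (V w, U w)). f (fst p - snd p))
      = (LINT p|distr M (borel \<Otimes>\<^sub>M borel) (\<lambda>w. (U w, V w)). f (fst p - snd p))"
    by (simp only: distr_swap)
  then show ?thesis
    by (simp add: integral_distr)
qed

lemma integral_indep:
  fixes f g :: "real \<Rightarrow> 'b::{real_normed_field, banach, second_countable_topology}"
  assumes [measurable]: "f \<in> borel_measurable borel" "g \<in> borel_measurable borel"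
    and "integrable M (\<lambda>w. f (U w))" "integrable M (\<lambda>w. g (U w))"
  shows "integrable M (\<lambda>w. f (U w) * g (V w))"
    and "(LINT w|M. f (U w) * g (V w)) = (LINT w|M. f (U w)) * (LINT w|M. g (U w))"
proof -
  have "indep_var borel (\<lambda>w. f (U w)) borel (\<lambda>w. g (V w))"
    using indep_var_compose[OF indep assms(1,2)] by (simp add: comp_def)
  moreover have "integrable M (\<lambda>w. g (V w))"
    using assms by (simp add: integrable_V_iff)
  ultimately show "integrable M (\<lambda>w. f (U w) * g (V w))"
    and "(LINT w|M. f (U w) * g (V w)) = (LINT w|M. f (U w)) * (LINT w|M. g (U w))"
    using assms(3) by (simp_all add: indep_var_integrable indep_var_lebesgue_integral integral_V)
qed

end

locale abs_diff_law = iid_pair M U V for M :: "'a measure" and U V :: "'a \<Rightarrow> real" +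
  assumes nonneg_U: "AE w in M. 0 \<le> U w"
    and abs_diff: "distr M borel (\<lambda>w. \<bar>U w - V w\<bar>) = distr M borel U"
    and ac: "absolutely_continuous lborel (distr M borel U)"
begin

lemma nonneg_V: "AE w in M. 0 \<le> V w"
  by (rule AE_V[OF nonneg_U]) simp

text \<open>Absolute continuity rules out an atom at 0. Strict monotonicity of
  \<open>laplace\<close> and its limit 0 both rest on this; in general that limit is the mass at
  0.\<close>

lemma pos_U: "AE w in M. 0 < U w"
proof -
  have "AE w in M. U w \<notin> {0}"
    by (rule AE_notin_null[OF ac]) (simp add: finite_imp_null_set_lborel)
  with nonneg_U show ?thesis
    by eventually_elim auto
qed

lemma integral_abs_diff:
  fixes f :: "real \<Rightarrow> 'b::{banach, second_countable_topology}"
  assumes [measurable]: "f \<in> borel_measurable borel"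
  shows "(LINT w|M. f \<bar>U w - V w\<bar>) = (LINT w|M. f (U w))"
proof -
  have "(LINT x|distr M borel (\<lambda>w. \<bar>U w - V w\<bar>). f x) = (LINT x|distr M borel U. f x)"
    by (simp only: abs_diff)
  then show ?thesis
    by (simp add: integral_distr)
qed

section \<open>The real Laplace transform and exponential moments\<close>

definition laplace :: "real \<Rightarrow> real" where
  "laplace r = (LINT w|M. exp (- (r * U w)))"

lemma integrable_exp_neg:
  assumes "0 \<le> r"
  shows "integrable M (\<lambda>w. exp (- (r * U w)))"
proof (rule integrable_const_bound[where B = 1])
  show "AE w in M. norm (exp (- (r * U w))) \<le> 1"
    using nonneg_U by eventually_elim (use assms in auto)
qed simp

text \<open>Truncation makes the moment \<open>m\<close> finite before anything is known about
  tails. The law of the absolute difference and symmetry give \<open>m - 1 = 2 * E\<close>, where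
  \<open>E\<close> is the mean of \<open>k (U w - V w)\<close>. Comparing exponents gives
  \<open>m * laplace r - 1 \<le> E\<close>. Eliminating \<open>E\<close> leaves
  \<open>m * (2 * laplace r - 1) \<le> 1\<close>, a bound free of \<open>n\<close>.\<close>

lemma truncated_moment_le:
  fixes n :: real
  assumes r: "0 < r" "1 / 2 < laplace r" and n: "0 \<le> n"
  shows "(LINT w|M. exp (r * min (U w) n)) \<le> 1 / (2 * laplace r - 1)"
proof -
  \<comment> \<open>Subtracting 1 makes \<open>k\<close> vanish on the negative half-line, so that
    \<open>k \<bar>x\<bar> = k x + k (- x)\<close>.\<close>
  define k where "k x = exp (r * min (max x 0) n) - 1" for x
  define m where "m = (LINT w|M. exp (r * min (U w) n))"
  have [measurable]: "k \<in> borel_measurable borel"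
    unfolding k_def by measurable
  have k_bound: "norm (k x) \<le> exp (r * n) + 1" for x
  proof -
    have "exp (r * min (max x 0) n) \<le> exp (r * n)"
      using r by simp
    then show ?thesis
      unfolding k_def by (smt (verit) exp_gt_zero real_norm_def)
  qed
  have int_k: "integrable M (\<lambda>w. k (f w))" if "f \<in> borel_measurable M" for f
    using that k_bound by (intro integrable_const_bound[where B = "exp (r * n) + 1"]) auto
  have int_e: "integrable M (\<lambda>w. exp (r * min (U w) n))"
    using r by (intro integrable_const_bound[where B = "exp (r * n)"]) auto
  have int_prod: "integrable M (\<lambda>w. exp (r * min (U w) n) * exp (- (r * V w)))"
    and prod: "(LINT w|M. exp (r * min (U w) n) * exp (- (r * V w))) = m * laplace r"
    using integral_indep[of "\<lambda>x. exp (r * min x n)" "\<lambda>x. exp (- (r * x))"]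
      int_e integrable_exp_neg[of r] r by (simp_all add: m_def laplace_def)
  have "m - 1 = (LINT w|M. exp (r * min (U w) n) - 1)"
    using int_e by (simp add: m_def prob_space)
  also have "\<dots> = (LINT w|M. k (U w))"
  proof (rule integral_cong_AE)
    show "AE w in M. exp (r * min (U w) n) - 1 = k (U w)"
      using nonneg_U by eventually_elim (simp add: k_def max_absorb1)
  qed simp_all
  also have "\<dots> = (LINT w|M. k \<bar>U w - V w\<bar>)"
    by (simp add: integral_abs_diff)
  also have "\<dots> = (LINT w|M. k (U w - V w) + k (V w - U w))"
    by (intro Bochner_Integration.integral_cong) (auto simp: k_def max_def n)
  also have "\<dots> = 2 * (LINT w|M. k (U w - V w))"
    by (simp add: int_k integral_diff_swap)
  finally have "m - 1 = 2 * (LINT w|M. k (U w - V w))" .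
  moreover have "m * laplace r - 1 \<le> (LINT w|M. k (U w - V w))"
  proof -
    have "m * laplace r - 1 = (LINT w|M. exp (r * min (U w) n) * exp (- (r * V w)) - 1)"
      using int_prod by (simp add: prod prob_space)
    also have "\<dots> \<le> (LINT w|M. k (U w - V w))"
    proof (rule integral_mono_AE)
      show "AE w in M. exp (r * min (U w) n) * exp (- (r * V w)) - 1 \<le> k (U w - V w)"
        using nonneg_V
      proof eventually_elim
        case (elim w)
        \<comment> \<open>The left side is at most \<open>U w - V w\<close>, and also at most
          \<open>n\<close> because \<open>V w\<close> is nonnegative.\<close>
        have "min (U w) n - V w \<le> min (max (U w - V w) 0) n"
          using elim n by auto
        then have "r * (min (U w) n - V w) \<le> r * min (max (U w - V w) 0) n"
          using r by simp
        then show ?case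
          by (simp add: k_def right_diff_distrib flip: exp_add)
      qed
    qed (use int_prod int_k in auto)
    finally show ?thesis .
  qed
  ultimately have "m * (2 * laplace r - 1) \<le> 1"
    by (simp add: algebra_simps)
  then show ?thesis
    using r by (simp add: m_def field_simps)
qed

text \<open>The bound on the truncated moments does not depend on the truncation level, so monotone
  convergence removes the truncation.\<close>

lemma exp_moment:
  assumes r: "0 < r" "1 / 2 < laplace r"
  shows "integrable M (\<lambda>w. exp (r * U w))"
proof -
  let ?f = "\<lambda>(n::nat) w. exp (r * min (U w) (real n))"
  have int: "integrable M (?f n)" for n
    using r by (intro integrable_const_bound[where B = "exp (r * n)"]) auto
  have "incseq (\<lambda>n. integral\<^sup>L M (?f n))"
    using int[of "Suc _"] int r by (intro incseq_SucI integral_mono) (auto intro!: mult_left_mono simp del: of_nat_Suc)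
  then obtain L where L: "(\<lambda>n. integral\<^sup>L M (?f n)) \<longlonglongrightarrow> L"
    using truncated_moment_le[OF r] by (elim incseq_convergent[where B = "1 / (2 * laplace r - 1)"]) auto
  show ?thesis
  proof (rule integrable_monotone_convergence[OF int _ _ L])
    show "AE w in M. mono (\<lambda>n. ?f n w)"
      using r by (intro AE_I2 monoI) (auto intro!: mult_left_mono)
    show "AE w in M. (\<lambda>n. ?f n w) \<longlonglongrightarrow> exp (r * U w)"
    proof (intro AE_I2 tendsto_eventually)
      fix w
      obtain N where "U w \<le> real N" using real_arch_simple by blast
      then show "eventually (\<lambda>n. ?f n w = exp (r * U w)) sequentially"
        by (intro eventually_sequentiallyI[of N]) auto
    qed
  qed simp
qed

lemma laplace_less:
  assumes "0 \<le> r" "r < s"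
  shows "laplace s < laplace r"
  unfolding laplace_def
proof (rule integral_less_AE_space)
  show "AE w in M. exp (- (s * U w)) < exp (- (r * U w))"
    using pos_U by eventually_elim (use assms in auto)
qed (use assms in \<open>auto intro!: integrable_exp_neg simp: emeasure_space_1\<close>)

lemma laplace_continuous: "continuous_on {0..} laplace"
proof (rule continuous_on_sequentiallyI)
  fix X :: "nat \<Rightarrow> real" and r
  assume X: "\<forall>n. X n \<in> {0..}" "r \<in> {0..}" "X \<longlonglongrightarrow> r"
  show "(\<lambda>n. laplace (X n)) \<longlonglongrightarrow> laplace r"
    unfolding laplace_def
  proof (rule integral_dominated_convergence[where w = "\<lambda>_. 1"])
    show "AE w in M. (\<lambda>n. exp (- (X n * U w))) \<longlonglongrightarrow> exp (- (r * U w))"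
      using X by (intro AE_I2 tendsto_intros)
    show "AE w in M. norm (exp (- (X n * U w))) \<le> 1" for n
      using nonneg_U by eventually_elim (use X in auto)
  qed auto
qed

lemma laplace_at_top: "(\<lambda>n. laplace (real n)) \<longlonglongrightarrow> 0"
proof -
  have "(\<lambda>n. LINT w|M. exp (- (real n * U w))) \<longlonglongrightarrow> (LINT w|M. 0)"
  proof (rule integral_dominated_convergence[where w = "\<lambda>_. 1"])
    show "AE w in M. (\<lambda>n. exp (- (real n * U w))) \<longlonglongrightarrow> 0"
      using pos_U
    proof eventually_elim
      case (elim w)
      have "(\<lambda>n. exp (- U w) ^ n) \<longlonglongrightarrow> 0"
        using elim by (intro LIMSEQ_realpow_zero) auto
      then show ?case
        by (simp flip: exp_of_nat_mult)
    qed
    show "AE w in M. norm (exp (- (real n * U w))) \<le> 1" for n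
      using nonneg_U by eventually_elim auto
  qed auto
  then show ?thesis
    by (simp add: laplace_def)
qed

text \<open>The intermediate value theorem between the value 1 at 0 and the limit 0. An exponential
  law of rate c has transform c / (c + s), which equals 1/2 exactly at s = c, so the point found
  here is the only candidate for the rate.\<close>

lemma laplace_half_exists: "\<exists>c>0. laplace c = 1 / 2"
proof -
  have "eventually (\<lambda>n. laplace (real n) < 1 / 2) sequentially"
    using order_tendstoD(2)[OF laplace_at_top, of "1/2"] by simp
  then obtain n where n: "laplace (real n) < 1 / 2"
    by (auto simp: eventually_sequentially)
  have "laplace 0 = 1"
    by (simp add: laplace_def prob_space)
  moreover have "continuous_on {0..real n} laplace"
    by (rule continuous_on_subset[OF laplace_continuous]) auto
  ultimately obtain c where "0 \<le> c" "laplace c = 1 / 2"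
    using IVT2'[of laplace "real n" "1/2" 0] n by auto
  with \<open>laplace 0 = 1\<close> show ?thesis
    by (cases "c = 0") (auto intro!: exI[of _ c])
qed

section \<open>The complex Laplace transform\<close>

definition claplace :: "complex \<Rightarrow> complex" where
  "claplace s = (LINT w|M. exp (- (s * of_real (U w))))"

lemma claplace_of_real: "claplace (of_real r) = of_real (laplace r)"
proof -
  have "claplace (of_real r) = (LINT w|M. of_real (exp (- (r * U w))))"
    unfolding claplace_def by (simp add: exp_of_real[symmetric])
  then show ?thesis
    by (simp add: laplace_def)
qed

lemma integrable_cexp:
  assumes "integrable M (\<lambda>w. exp (- (Re s * U w)))"
  shows "integrable M (\<lambda>w. exp (- (s * of_real (U w))))"
  by (rule Bochner_Integration.integrable_bound[OF assms]) auto

lemma norm_claplace_le: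
  assumes "0 \<le> Re s"
  shows "norm (claplace s) \<le> laplace (Re s)"
proof -
  have "norm (claplace s) \<le> (LINT w|M. norm (exp (- (s * of_real (U w)))))"
    unfolding claplace_def by (rule integral_norm_bound)
  also have "\<dots> = laplace (Re s)"
    by (simp add: laplace_def)
  finally show ?thesis .
qed

lemma claplace_vanishes: "(claplace \<longlongrightarrow> 0) at_infinity_right"
proof -
  let ?D = "distr M borel U"
  interpret D: prob_space ?D
    by (rule prob_space_distr) simp
  obtain f where f [measurable]: "f \<in> borel_measurable lborel"
    and RN: "AE x in lborel. RN_deriv lborel ?D x = ennreal (f x)" and pos: "\<And>x. 0 \<le> f x"
    using sigma_finite_measure.real_RN_deriv[OF sigma_finite_lborel D.finite_measure_axioms ac] by auto
  have D: "density lborel (\<lambda>x. ennreal (f x)) = ?D"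
  proof -
    have "density lborel (\<lambda>x. ennreal (f x)) = density lborel (RN_deriv lborel ?D)"
      using RN by (intro density_cong) auto
    also have "\<dots> = ?D"
      by (rule sigma_finite_measure.density_RN_deriv[OF sigma_finite_lborel ac]) simp
    finally show ?thesis .
  qed
  have "AE x in ?D. 0 \<le> x"
    using nonneg_U by (subst AE_distr_iff) auto
  \<comment> \<open>The density vanishes almost everywhere on the negative half-line, so the
    indicator in \<open>halfline_laplace\<close> changes nothing.\<close>
  then have f0: "AE x in lborel. 0 < f x \<longrightarrow> 0 \<le> x"
    unfolding D[symmetric] by (subst (asm) AE_density) auto
  have "integrable ?D (\<lambda>x. 1 :: real)"
    by simp
  then have int: "integrable lborel f"
    unfolding D[symmetric] using pos by (subst (asm) integrable_density) auto
  have "claplace s = halfline_laplace f s" for s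
  proof -
    have "claplace s = (LINT x|?D. exp (- (s * of_real x)))"
      by (simp add: claplace_def integral_distr)
    also have "\<dots> = (LINT x|lborel. f x *\<^sub>R exp (- (s * of_real x)))"
      unfolding D[symmetric] using pos by (subst integral_density) auto
    also have "\<dots> = halfline_laplace f s"
      unfolding halfline_laplace_def
    proof (rule integral_cong_AE)
      show "AE x in lborel. f x *\<^sub>R exp (- (s * of_real x))
          = (indicator {0..} x * f x) *\<^sub>R exp (- (s * of_real x))"
        using f0
      proof eventually_elim
        case (elim x)
        then show ?case
          using pos[of x] by (cases "0 \<le> x") auto
      qed
    qed measurable
    finally show ?thesis .
  qed
  then have "claplace = halfline_laplace f" ..
  then show ?thesis
    using Riemann_Lebesgue_halfplane[OF int] by (simp add: laplace_vanishes_def)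
qed

section \<open>Holomorphy, reflection and zeros for a fixed c\<close>

context
  fixes c :: real
  assumes c: "0 < c" "laplace c = 1 / 2"
begin

text \<open>For \<open>r\<close> between \<open>- c\<close> and 0, strict monotonicity gives
  \<open>laplace (- r)\<close> a value above \<open>laplace c = 1 / 2\<close>, which is what
  \<open>exp_moment\<close> asks for. The boundary line Re s = -c of the domain of holomorphy
  originates here.\<close>

lemma integrable_exp_right:
  assumes "- c < r"
  shows "integrable M (\<lambda>w. exp (- (r * U w)))"
proof (cases "0 \<le> r")
  case True
  then show ?thesis by (rule integrable_exp_neg)
next
  case False
  then have "1 / 2 < laplace (- r)"
    using laplace_less[of "- r" c] c assms by simp
  then show ?thesis
    using exp_moment[of "- r"] False by simp
qed

text \<open>Differentiation under the integral: the difference quotients are dominated by one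
  integrable function, uniformly in small increments.\<close>

lemma claplace_has_field_derivative:
  assumes s: "- c < Re s"
  shows "(claplace has_field_derivative (LINT w|M. - of_real (U w) * exp (- (s * of_real (U w))))) (at s)"
    (is "(_ has_field_derivative ?D) _")
proof -
  \<comment> \<open>A third of the distance to the line Re s = -c. One third is spent on increments
    with \<open>norm h < d\<close>, one on absorbing the factor \<open>u\<close> through
    \<open>u \<le> exp (d * u) / d\<close>; the last keeps the exponent of \<open>w\<close> to the
    right of \<open>- c\<close>.\<close>
  define d where "d = (Re s + c) / 3"
  have d: "0 < d" "- c < Re s - 2 * d"
    using s by (auto simp: d_def field_simps)
  define w where "w x = exp (- ((Re s - 2 * d) * U x)) / d" for x
  have int_w: "integrable M w"
    unfolding w_def using d by (intro integrable_divide integrable_exp_right)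
  have "((\<lambda>h. (claplace (s + h) - claplace s) / h) \<longlongrightarrow> ?D) (at 0)"
    unfolding tendsto_at_iff_sequentially
  proof (intro allI impI)
    fix X :: "nat \<Rightarrow> complex"
    assume X: "\<forall>i. X i \<in> UNIV - {0}" "X \<longlonglongrightarrow> 0"
    then have "eventually (\<lambda>n. norm (X n) < d) sequentially"
      using order_tendstoD(2)[OF tendsto_norm[OF X(2)], of d] d by simp
    then obtain N where N: "\<And>n. N \<le> n \<Longrightarrow> norm (X n) < d"
      by (auto simp: eventually_sequentially)
    define q where "q h x = (exp (- ((s + h) * of_real (U x))) - exp (- (s * of_real (U x)))) / h" for h x
    have q_eq: "(claplace (s + h) - claplace s) / h = (LINT x|M. q h x)" if "norm h < d" for h
    proof -
      have "\<bar>Re h\<bar> < d"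
        using that abs_Re_le_cmod[of h] by simp
      then have "integrable M (\<lambda>x. exp (- ((s + h) * of_real (U x))))"
        using d by (intro integrable_cexp integrable_exp_right) auto
      moreover have "integrable M (\<lambda>x. exp (- (s * of_real (U x))))"
        using s by (intro integrable_cexp integrable_exp_right)
      ultimately show ?thesis
        by (simp add: claplace_def q_def)
    qed
    have "(\<lambda>n. LINT x|M. q (X (n + N)) x) \<longlonglongrightarrow> ?D"
    proof (rule integral_dominated_convergence[where w = w])
      show "AE x in M. (\<lambda>n. q (X (n + N)) x) \<longlonglongrightarrow> - of_real (U x) * exp (- (s * of_real (U x)))"
      proof (rule AE_I2)
        fix x
        have "((\<lambda>z. exp (- (z * of_real (U x)))) has_field_derivative
            - of_real (U x) * exp (- (s * of_real (U x)))) (at s)"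
          by (auto intro!: derivative_eq_intros)
        then have "((\<lambda>h. q h x) \<longlongrightarrow> - of_real (U x) * exp (- (s * of_real (U x)))) (at 0)"
          by (simp add: DERIV_def q_def)
        moreover have "filterlim (\<lambda>n. X (n + N)) (at 0) sequentially"
          using X LIMSEQ_ignore_initial_segment[OF X(2), of N] by (auto simp: filterlim_at)
        ultimately show "(\<lambda>n. q (X (n + N)) x) \<longlonglongrightarrow> - of_real (U x) * exp (- (s * of_real (U x)))"
          by (rule filterlim_compose)
      qed
      show "AE x in M. norm (q (X (n + N)) x) \<le> w x" for n
        using nonneg_U
      proof eventually_elim
        case (elim x)
        define h where "h = X (n + N)"
        have h: "h \<noteq> 0" "norm h \<le> d"
          using X(1) N[of "n + N"] by (auto simp: h_def)
        define u where "u = U x"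
        have u: "0 \<le> u" using elim by (simp add: u_def)
        have "exp (- ((s + h) * of_real u)) = exp (- (s * of_real u)) * exp (- (h * of_real u))"
          by (simp add: distrib_right flip: exp_add)
        then have "q h x = exp (- (s * of_real u)) * (exp (- (h * of_real u)) - 1) / h"
          by (simp add: q_def u_def right_diff_distrib)
        then have "norm (q h x) = exp (- (Re s * u)) * norm (exp (- (h * of_real u)) - 1) / norm h"
          by (simp add: norm_mult norm_divide)
        also have "\<dots> \<le> exp (- (Re s * u)) * (norm h * u * exp (norm h * u)) / norm h"
          using norm_exp_minus_one_le[of "- (h * of_real u)"] u
          by (intro divide_right_mono mult_left_mono) (auto simp: norm_mult)
        also have "\<dots> = exp (- (Re s * u)) * (u * exp (norm h * u))"
          using h by simp
        also have "\<dots> \<le> exp (- (Re s * u)) * ((exp (d * u) / d) * exp (d * u))"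
        proof (intro mult_left_mono mult_mono)
          have "d * u \<le> exp (d * u)"
            using exp_ge_add_one_self[of "d * u"] by linarith
          then show "u \<le> exp (d * u) / d"
            using d by (simp add: field_simps)
          show "exp (norm h * u) \<le> exp (d * u)"
            using h u by (simp add: mult_right_mono)
        qed (use u d in auto)
        also have "\<dots> = exp (- (Re s * u) + d * u + d * u) / d"
          by (simp only: exp_add times_divide_eq_left times_divide_eq_right mult.assoc)
        also have "\<dots> = w x"
          by (simp add: w_def u_def algebra_simps)
        finally show ?case
          by (simp add: h_def)
      qed
      show "q (X (n + N)) \<in> borel_measurable M" for n
        unfolding q_def by measurable
      show "(\<lambda>x. - of_real (U x) * exp (- (s * of_real (U x)))) \<in> borel_measurable M"
        by measurable
    qed (rule int_w)
    moreover have "(claplace (s + X (n + N)) - claplace s) / X (n + N) = (LINT x|M. q (X (n + N)) x)" for n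
      by (rule q_eq) (rule N, simp)
    ultimately have "(\<lambda>n. (claplace (s + X (n + N)) - claplace s) / X (n + N)) \<longlonglongrightarrow> ?D"
      by (simp only:)
    then have "(\<lambda>n. ((\<lambda>h. (claplace (s + h) - claplace s) / h) \<circ> X) (n + N)) \<longlonglongrightarrow> ?D"
      by (simp add: comp_def)
    then show "((\<lambda>h. (claplace (s + h) - claplace s) / h) \<circ> X) \<longlonglongrightarrow> ?D"
      by (rule LIMSEQ_offset)
  qed
  then show ?thesis
    by (simp add: DERIV_def)
qed

lemma claplace_holomorphic: "claplace holomorphic_on {s. - c < Re s}"
proof (rule holomorphic_onI)
  fix s assume "s \<in> {s. - c < Re s}"
  then have "- c < Re s" by simp
  from has_field_derivative_at_within[OF claplace_has_field_derivative[OF this]]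
  show "claplace field_differentiable at s within {s. - c < Re s}"
    unfolding field_differentiable_def by (rule exI)
qed

text \<open>Independence turns the product L(s) L(-s) into the mean of exp (-s (U - V)), and by
  symmetry also into that of exp (-s (V - U)). The sum of the two exponentials is even in the
  difference, so it may be evaluated at the absolute difference, which has the law of
  \<open>U\<close>. This gives 2 L(s) L(-s) = L(s) + L(-s), the claim after factoring.\<close>

lemma claplace_reflection:
  assumes s: "- c < Re s" "Re s < c"
  shows "(2 * claplace s - 1) * (2 * claplace (- s) - 1) = 1"
proof -
  define F where "F z x = exp (- (z * of_real x))" for z :: complex and x :: real
  have [measurable]: "F z \<in> borel_measurable borel" for z
    unfolding F_def by measurable
  have int: "integrable M (\<lambda>w. F s (U w))" "integrable M (\<lambda>w. F (- s) (U w))"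
    unfolding F_def using s by (intro integrable_cexp integrable_exp_right; simp)+
  have prod: "F s (U w) * F (- s) (V w) = F s (U w - V w)" for w
    by (simp add: F_def right_diff_distrib flip: exp_add)
  have prod': "F s (V w) * F (- s) (U w) = F s (V w - U w)" for w
    by (simp add: F_def right_diff_distrib flip: exp_add)
  have int1: "integrable M (\<lambda>w. F s (U w - V w))"
    using integral_indep(1)[of "F s" "F (- s)"] int by (simp add: prod)
  have int2: "integrable M (\<lambda>w. F s (V w - U w))"
    using integral_indep(1)[of "F (- s)" "F s"] int by (simp add: prod' mult.commute)
  have "claplace s * claplace (- s) = (LINT w|M. F s (U w - V w))"
    using integral_indep(2)[of "F s" "F (- s)"] int
    by (simp add: prod) (simp add: claplace_def F_def)
  then have "2 * (claplace s * claplace (- s)) = (LINT w|M. F s (U w - V w)) + (LINT w|M. F s (V w - U w))"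
    by (simp add: integral_diff_swap)
  also have "\<dots> = (LINT w|M. F s (U w - V w) + F s (V w - U w))"
    using int1 int2 by simp
  also have "\<dots> = (LINT w|M. F s \<bar>U w - V w\<bar> + F (- s) \<bar>U w - V w\<bar>)"
    by (intro Bochner_Integration.integral_cong) (auto simp: F_def abs_if algebra_simps)
  also have "\<dots> = (LINT w|M. F s (U w) + F (- s) (U w))"
    by (rule integral_abs_diff) simp
  also have "\<dots> = claplace s + claplace (- s)"
    using int by simp (simp add: claplace_def F_def)
  finally show ?thesis
    by (simp add: algebra_simps)
qed

text \<open>To the left of the line Re s = c a zero of 2 L - 1 would make the reflection relation
  read 0 = 1. To the right, |L(s)| is at most L(Re s), which is below 1/2. On the line, L(s) = L(c)
  is possible only if the cosine factor is almost surely 1.\<close>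

lemma claplace_half_iff:
  assumes "0 \<le> Re s"
  shows "claplace s = 1 / 2 \<longleftrightarrow> s = of_real c"
proof
  assume half: "claplace s = 1 / 2"
  have "Re s \<ge> c"
  proof (rule ccontr)
    assume "\<not> c \<le> Re s"
    with claplace_reflection[of s] half assms c show False by simp
  qed
  moreover have "Re s \<le> c"
  proof (rule ccontr)
    assume "\<not> Re s \<le> c"
    then have "laplace (Re s) < 1 / 2"
      using laplace_less[of c "Re s"] c by simp
    with norm_claplace_le[OF assms] half show False by simp
  qed
  ultimately have Re: "Re s = c" by simp
  have "Im s = 0"
  proof (rule ccontr)
    assume Im: "Im s \<noteq> 0"
    \<comment> \<open>The values of \<open>U\<close> at which the cosine equals 1 form a countable
      set, which an absolutely continuous law does not charge.\<close>
    define N where "N = (\<lambda>k::int. of_int k * (2 * pi) / Im s) ` UNIV"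
    have "countable N"
      by (simp add: N_def)
    then have "AE w in M. U w \<notin> N"
      by (intro AE_notin_null[OF ac] countable_imp_null_set_lborel)
    then have "AE w in M. exp (- (c * U w)) * cos (Im s * U w) < exp (- (c * U w))"
    proof eventually_elim
      case (elim w)
      have "cos (Im s * U w) \<noteq> 1"
      proof
        assume "cos (Im s * U w) = 1"
        then obtain k :: int where "Im s * U w = of_int k * (2 * pi)"
          by (auto simp: cos_one_2pi_int mult_ac)
        then have "U w = of_int k * (2 * pi) / Im s"
          using Im by (simp add: field_simps)
        with elim show False by (auto simp: N_def)
      qed
      then have "cos (Im s * U w) < 1"
        using cos_le_one[of "Im s * U w"] by linarith
      then show ?case by simp
    qed
    moreover have int: "integrable M (\<lambda>w. exp (- (s * of_real (U w))))"
      using Re c by (intro integrable_cexp integrable_exp_neg) simp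
    have Re_exp: "Re (exp (- (s * of_real (U w)))) = exp (- (c * U w)) * cos (Im s * U w)" for w
      by (simp add: Re_exp Re)
    have int': "integrable M (\<lambda>w. exp (- (c * U w)) * cos (Im s * U w))"
      using integrable_Re[OF int] by (simp add: Re_exp)
    ultimately have "(LINT w|M. exp (- (c * U w)) * cos (Im s * U w)) < laplace c"
      unfolding laplace_def using c
      by (intro integral_less_AE_space) (auto intro: integrable_exp_neg simp: emeasure_space_1)
    moreover have "Re (claplace s) = (LINT w|M. exp (- (c * U w)) * cos (Im s * U w))"
      unfolding claplace_def using integral_Re[OF int] by (simp add: Re_exp)
    ultimately show False
      using half c by simp
  qed
  with Re show "s = of_real c"
    by (simp add: complex_eq_iff)
qed (simp add: claplace_of_real c)

text \<open>The derivative is minus the mean of the almost surely positive variable U exp (-c U).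
  Hence the zero of 2 L - 1 at c is simple and one linear factor cancels it.\<close>

lemma deriv_claplace_nonzero: "deriv claplace (of_real c) \<noteq> 0"
proof -
  have d: "deriv claplace (of_real c)
      = (LINT w|M. - of_real (U w) * exp (- (of_real c * of_real (U w))))"
    using c by (intro DERIV_imp_deriv claplace_has_field_derivative) simp
  also have "\<dots> = of_real (LINT w|M. - U w * exp (- (c * U w)))"
    by (subst integral_complex_of_real[symmetric]) (simp add: exp_of_real[symmetric])
  finally have eq: "deriv claplace (of_real c) = of_real (LINT w|M. - U w * exp (- (c * U w)))" .
  have int: "integrable M (\<lambda>w. U w * exp (- (c * U w)))"
  proof (rule integrable_const_bound[where B = "1 / c"])
    show "AE w in M. norm (U w * exp (- (c * U w))) \<le> 1 / c"
      using nonneg_U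
    proof eventually_elim
      case (elim w)
      have "c * U w \<le> exp (c * U w)"
        using exp_ge_add_one_self[of "c * U w"] by linarith
      then show ?case
        using c elim by (simp add: exp_minus field_simps abs_mult)
    qed
  qed simp
  have "(LINT w|M. 0) < (LINT w|M. U w * exp (- (c * U w)))"
    using int pos_U by (intro integral_less_AE_space) (auto simp: emeasure_space_1)
  then show ?thesis
    unfolding eq by simp
qed

lemma claplace_eq:
  assumes s: "0 \<le> Re s"
  shows "claplace s = of_real c / (of_real c + s)"
proof -
  define W where "W z = 2 * claplace z - 1" for z
  \<comment> \<open>The difference quotient of \<open>W\<close> at its zero c, with the removable
    singularity filled in; \<open>pole_lemma_open\<close> makes it holomorphic across c.\<close>
  define R where "R z = (if z = of_real c then deriv W (of_real c)
    else (W z - W (of_real c)) / (z - of_real c))" for z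
  define K where "K z = - R z * (z + of_real c)" for z
  \<comment> \<open>By reflection both branches agree on the strip |Re z| < c. So \<open>E\<close>
    equals \<open>K\<close> on all of \<open>?S\<close> and \<open>1 / K (- z)\<close> on all of
    \<open>?T\<close>, two overlapping open half-planes that cover the plane.\<close>
  define E where "E z = (if 0 \<le> Re z then K z else 1 / K (- z))" for z
  let ?S = "{z. - c < Re z}" and ?T = "{z. Re z < c}"
  have S: "open ?S" and T: "open ?T"
    by (rule open_halfspace_Re_gt, rule open_halfspace_Re_lt)
  have W_c: "W (of_real c) = 0"
    by (simp add: W_def claplace_of_real c)
  have W_hol: "W holomorphic_on ?S"
    unfolding W_def by (intro holomorphic_intros claplace_holomorphic)
  have deriv_W: "deriv W (of_real c) = 2 * deriv claplace (of_real c)"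
  proof -
    have "(claplace has_field_derivative deriv claplace (of_real c)) (at (of_real c))"
      by (rule holomorphic_derivI[OF claplace_holomorphic S]) (use c in simp)
    then have "(W has_field_derivative 2 * deriv claplace (of_real c)) (at (of_real c))"
      unfolding W_def by (auto intro!: derivative_eq_intros)
    then show ?thesis
      by (rule DERIV_imp_deriv)
  qed
  have K_off: "K z = - W z * (z + of_real c) / (z - of_real c)" if "z \<noteq> of_real c" for z
    using that by (simp add: K_def R_def W_c)
  have K_hol: "K holomorphic_on ?S"
    unfolding K_def R_def by (intro holomorphic_intros pole_lemma_open W_hol S)
  have K_refl: "K z * K (- z) = 1" if z: "- c < Re z" "Re z < c" for z
  proof -
    have ne: "z \<noteq> of_real c" "- z \<noteq> of_real c"
      using z by (auto dest: arg_cong[where f = Re])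
    then have ne': "z - of_real c \<noteq> 0" "z + of_real c \<noteq> 0"
      by (metis eq_iff_diff_eq_0 add_eq_0_iff minus_equation_iff)+
    have "W z * W (- z) = 1"
      using claplace_reflection[OF z] by (simp add: W_def)
    moreover have "K z * K (- z) = (W z * W (- z)) *
        (((z + of_real c) * (- z + of_real c)) / ((z - of_real c) * (- z - of_real c)))"
      by (simp add: K_off ne)
    \<comment> \<open>The rational factor times its own reflection is 1, so \<open>K\<close>
      inherits the relation of \<open>W\<close>.\<close>
    moreover have "(z + of_real c) * (- z + of_real c) = (z - of_real c) * (- z - of_real c)"
      by (simp add: algebra_simps)
    moreover have "(z - of_real c) * (- z - of_real c) \<noteq> 0"
    proof -
      have "- z - of_real c = - (z + of_real c)"
        by simp
      with ne' show ?thesis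
        by (simp only: mult_eq_0_iff neg_equal_0_iff_equal not_False_eq_True simp_thms)
    qed
    ultimately show ?thesis
      by simp
  qed
  \<comment> \<open>On the closed right half-plane the only zero of \<open>W\<close> is c, and being
    simple it has been divided out. Left of the imaginary axis the reflection relation excludes
    zeros.\<close>
  have K_nz: "K z \<noteq> 0" if "- c < Re z" for z
  proof (cases "0 \<le> Re z")
    case True
    have "z + of_real c \<noteq> 0"
      using True c by (auto simp: complex_eq_iff)
    moreover have "R z \<noteq> 0"
    proof (cases "z = of_real c")
      case True
      then show ?thesis
        by (simp add: R_def deriv_W deriv_claplace_nonzero)
    next
      case False
      then have "claplace z \<noteq> 1 / 2"
        using claplace_half_iff[OF True] by simp
      then have "W z \<noteq> 0"
        by (auto simp: W_def field_simps)
      then show ?thesis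
        using False by (simp add: R_def W_c)
    qed
    ultimately show ?thesis
      by (simp add: K_def)
  next
    case False
    then show ?thesis
      using K_refl[of z] that c by auto
  qed
  have "E holomorphic_on ?S"
  proof (rule holomorphic_transform[OF K_hol])
    fix z assume "z \<in> ?S"
    then have "K z * K (- z) = 1" if "\<not> 0 \<le> Re z"
      using K_refl[of z] that c by simp
    then show "K z = E z"
      by (auto simp: E_def eq_divide_eq)
  qed
  moreover have "E holomorphic_on ?T"
  proof (rule holomorphic_transform)
    have "(K \<circ> uminus) holomorphic_on ?T"
      by (rule holomorphic_on_compose_gen[OF _ K_hol]) (auto intro!: holomorphic_intros)
    then show "(\<lambda>z. 1 / K (- z)) holomorphic_on ?T"
      using K_nz by (intro holomorphic_intros) (auto simp: comp_def)
    fix z assume "z \<in> ?T"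
    then have "K z * K (- z) = 1" if "0 \<le> Re z"
      using K_refl[of z] that c by simp
    then show "1 / K (- z) = E z"
      by (auto simp: E_def divide_eq_eq)
  qed
  ultimately have "E holomorphic_on (?S \<union> ?T)"
    by (rule holomorphic_on_Un[OF _ _ S T])
  moreover have "?S \<union> ?T = UNIV"
    using c by auto
  ultimately have E_hol: "E holomorphic_on UNIV"
    by simp
  have K_lim: "(K \<longlongrightarrow> 1) at_infinity_right"
  proof -
    have "((\<lambda>z::complex. (z + of_real c) / (z - of_real c)) \<longlongrightarrow> 1) at_infinity"
    proof -
      have "((\<lambda>z::complex. of_real c / z) \<longlongrightarrow> 0) at_infinity"
        by (rule tendsto_divide_0[OF tendsto_const filterlim_ident])
      then have "((\<lambda>z::complex. (1 + of_real c / z) / (1 - of_real c / z)) \<longlongrightarrow> (1 + 0) / (1 - 0)) at_infinity"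
        by (intro tendsto_intros) auto
      then have "((\<lambda>z::complex. (1 + of_real c / z) / (1 - of_real c / z)) \<longlongrightarrow> 1) at_infinity"
        by simp
      moreover have "eventually (\<lambda>z::complex. (1 + of_real c / z) / (1 - of_real c / z)
          = (z + of_real c) / (z - of_real c)) at_infinity"
        using eventually_not_equal_at_infinity[of 0]
      proof eventually_elim
        case (elim z)
        then have "1 + of_real c / z = (z + of_real c) / z" "1 - of_real c / z = (z - of_real c) / z"
          by (simp_all add: field_simps)
        with elim show ?case by simp
      qed
      ultimately show ?thesis
        by (rule Lim_transform_eventually)
    qed
    then have "((\<lambda>z::complex. (z + of_real c) / (z - of_real c)) \<longlongrightarrow> 1) at_infinity_right"
      by (rule tendsto_mono[rotated]) simp
    then have "((\<lambda>z. - (2 * claplace z - 1) * ((z + of_real c) / (z - of_real c)))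
        \<longlongrightarrow> - (2 * 0 - 1) * 1) at_infinity_right"
      by (intro tendsto_mult tendsto_minus tendsto_diff tendsto_const claplace_vanishes)
    then have "((\<lambda>z. - (2 * claplace z - 1) * ((z + of_real c) / (z - of_real c))) \<longlongrightarrow> 1) at_infinity_right"
      by simp
    moreover have "eventually (\<lambda>z. - (2 * claplace z - 1) * ((z + of_real c) / (z - of_real c)) = K z)
        at_infinity_right"
      unfolding eventually_at_infinity_right
    proof (intro exI[of _ "c + 1"] allI impI)
      fix z :: complex assume "c + 1 \<le> norm z"
      then have "z \<noteq> of_real c"
        using c by auto
      then show "- (2 * claplace z - 1) * ((z + of_real c) / (z - of_real c)) = K z"
        by (simp add: K_off W_def)
    qed
    ultimately show ?thesis
      by (rule Lim_transform_eventually)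
  qed
  have uminus: "filterlim uminus at_infinity_right (inf at_infinity (principal {z. \<not> 0 \<le> Re z}))"
    unfolding filterlim_iff eventually_at_infinity_right eventually_inf_principal eventually_at_infinity
    by (metis mem_Collect_eq norm_minus_cancel minus_complex.simps uminus_complex.simps(1)
        neg_0_le_iff_le linear)
  have "(E \<longlongrightarrow> 1) at_infinity"
    unfolding E_def
  proof (rule filterlim_If)
    show "(K \<longlongrightarrow> 1) (inf at_infinity (principal {z. 0 \<le> Re z}))"
      by (rule K_lim)
    have "((\<lambda>z. K (- z)) \<longlongrightarrow> 1) (inf at_infinity (principal {z. \<not> 0 \<le> Re z}))"
      using filterlim_compose[OF K_lim uminus] .
    then show "((\<lambda>z. 1 / K (- z)) \<longlongrightarrow> 1) (inf at_infinity (principal {z. \<not> 0 \<le> Re z}))"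
      using tendsto_divide[OF tendsto_const[of 1]] by fastforce
  qed
  from Liouville_weak[OF E_hol this] have "E s = 1" .
  then have K1: "K s = 1"
    using s by (simp add: E_def)
  show ?thesis
  proof (cases "s = of_real c")
    case True
    have "claplace (of_real c) = of_real (1 / 2)"
      by (simp only: claplace_of_real c(2))
    with True c show ?thesis
      by simp
  next
    case False
    have "s + of_real c \<noteq> 0"
      using s c by (auto simp: complex_eq_iff)
    with K1 False have "2 * (claplace s * (of_real c + s)) = 2 * of_real c"
      by (simp add: K_off W_def field_simps)
    then have "claplace s * (of_real c + s) = of_real c"
      by simp
    with \<open>s + of_real c \<noteq> 0\<close> show ?thesis
      by (simp add: eq_divide_eq add.commute)
  qed
qed

end
end

section \<open>The exponential law and the Pareto law\<close>

lemma exponential_density_scaleR: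
  fixes z :: "'a::real_vector"
  shows "exponential_density r x *\<^sub>R z = r *\<^sub>R ((indicator {0..} x * exp (- (x * r))) *\<^sub>R z)"
  by (cases "x < 0") (simp_all add: exponential_density_def)

lemma integral_exp_halfline:
  fixes s :: complex
  assumes s: "0 < Re s"
  shows "(LINT x|lborel. indicator {0..} x *\<^sub>R exp (- (s * of_real x))) = 1 / s"
proof -
  have s0: "s \<noteq> 0"
    using s by auto
  \<comment> \<open>Up to the factor \<open>Re s\<close>, the dominating function is the density of
    a probability measure.\<close>
  have int: "integrable lborel (\<lambda>x. indicat_real {0..} x * exp (- (x * Re s)))"
  proof -
    interpret P: prob_space "density lborel (exponential_density (Re s))"
      by (rule prob_space_exponential_density[OF s])
    have "integrable (density lborel (exponential_density (Re s))) (\<lambda>x. 1 :: real)"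
      by simp
    then have "integrable lborel (\<lambda>x. exponential_density (Re s) x *\<^sub>R (1 :: real))"
      using s by (subst (asm) integrable_density) (auto simp: exponential_density_nonneg)
    then show ?thesis
      using s unfolding exponential_density_scaleR by simp
  qed
  let ?f = "\<lambda>(n::nat) x. indicator {0..real n} x *\<^sub>R exp (- (s * of_real x))"
  have "(\<lambda>n. LINT x|lborel. ?f n x) \<longlonglongrightarrow> (LINT x|lborel. indicator {0..} x *\<^sub>R exp (- (s * of_real x)))"
  proof (rule Bochner_Integration.integral_dominated_convergence[OF _ _ int])
    show "AE x in lborel. (\<lambda>n. ?f n x) \<longlonglongrightarrow> indicator {0..} x *\<^sub>R exp (- (s * of_real x))"
    proof (intro AE_I2 tendsto_eventually)
      fix x
      obtain N where "x \<le> real N" using real_arch_simple by blast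
      then show "eventually (\<lambda>n. ?f n x = indicator {0..} x *\<^sub>R exp (- (s * of_real x))) sequentially"
        by (intro eventually_sequentiallyI[of N]) (auto simp: indicator_def)
    qed
    show "AE x in lborel. norm (?f n x) \<le> indicat_real {0..} x * exp (- (x * Re s))" for n
      by (intro AE_I2) (auto simp: indicator_def mult.commute)
  qed auto
  moreover have "(\<lambda>n. LINT x|lborel. ?f n x) \<longlonglongrightarrow> 1 / s"
  proof -
    have "((\<lambda>n. exp (- (Re s * real n))) \<longlonglongrightarrow> 0)"
    proof -
      have "(\<lambda>n. exp (- Re s) ^ n) \<longlonglongrightarrow> 0"
        using s by (intro LIMSEQ_realpow_zero) auto
      then show ?thesis
        by (simp add: mult.commute flip: exp_of_nat_mult)
    qed
    then have "(\<lambda>n. exp (- (s * of_real (real n)))) \<longlonglongrightarrow> 0"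
      by (subst tendsto_norm_zero_iff[symmetric]) simp
    then have "(\<lambda>n. (1 - exp (- (s * of_real (real n)))) / s) \<longlonglongrightarrow> (1 - 0) / s"
      using s0 by (intro tendsto_intros)
    then show ?thesis
      using s0 by (simp add: integral_exp_Icc)
  qed
  ultimately show ?thesis
    by (rule LIMSEQ_unique)
qed

lemma char_exponential:
  assumes "0 < r"
  shows "char (density lborel (exponential_density r)) t = of_real r / (of_real r - \<i> * of_real t)"
proof -
  have "char (density lborel (exponential_density r)) t
      = (LINT x|lborel. exponential_density r x *\<^sub>R iexp (t * x))"
    unfolding char_def using assms
    by (subst integral_density) (auto simp: exponential_density_nonneg)
  also have "\<dots> = (LINT x|lborel. r *\<^sub>R (indicator {0..} x *\<^sub>R exp (- ((of_real r - \<i> * of_real t) * of_real x))))"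
    unfolding exponential_density_scaleR
    by (intro Bochner_Integration.integral_cong refl)
      (auto simp: indicator_def scaleR_conv_of_real algebra_simps simp flip: exp_add exp_of_real)
  also have "\<dots> = of_real r / (of_real r - \<i> * of_real t)"
    using assms by (subst integral_scaleR_right, subst integral_exp_halfline) (auto simp: scaleR_conv_of_real)
  finally show ?thesis .
qed

context abs_diff_law
begin

theorem exponential: "\<exists>c>0. distributed M lborel U (exponential_density c)"
proof -
  obtain c where c: "0 < c" "laplace c = 1 / 2"
    using laplace_half_exists by blast
  let ?E = "density lborel (exponential_density c)"
  have "distr M borel U = ?E"
  proof (rule Levy_uniqueness)
    interpret D: prob_space "distr M borel U"
      by (rule prob_space_distr) simp
    show "real_distribution (distr M borel U)"
      by unfold_locales auto
    interpret E: prob_space ?E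
      by (rule prob_space_exponential_density[OF c(1)])
    show "real_distribution ?E"
      by unfold_locales auto
    show "char (distr M borel U) = char ?E"
    proof
      fix t
      \<comment> \<open>On the imaginary axis the Laplace transform is the characteristic function,
        so the formula for \<open>claplace\<close> determines the law by Levy's uniqueness
        theorem.\<close>
      have "char (distr M borel U) t = claplace (- \<i> * of_real t)"
        by (simp add: char_def integral_distr claplace_def mult_ac)
      also have "\<dots> = of_real c / (of_real c + - \<i> * of_real t)"
        by (rule claplace_eq[OF c]) simp
      also have "\<dots> = char ?E t"
        by (simp add: char_exponential[OF c(1)])
      finally show "char (distr M borel U) t = char ?E t" .
    qed
  qed
  moreover have "distr M lborel U = distr M borel U"
    by (rule distr_cong) auto
  ultimately have "distributed M lborel U (exponential_density c)"
    using c by (simp add: distributed_def)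
  with c show ?thesis by blast
qed

end

text \<open>The set is the image of \<open>N\<close> under exp, and differentiable maps send
  negligible sets to negligible sets. This carries absolute continuity from a positive variable to
  its logarithm.\<close>

lemma ln_vimage_null_set:
  assumes N: "N \<in> null_sets lborel"
  shows "{x :: real. 0 < x \<and> ln x \<in> N} \<in> null_sets lborel"
proof -
  have [measurable]: "N \<in> sets borel"
    using N by auto
  have "negligible N"
    using N by (simp add: negligible_iff_null_sets null_sets_completionI)
  then have "negligible (exp ` N)"
    by (intro negligible_differentiable_image_negligible)
      (auto intro!: differentiable_at_imp_differentiable_on field_differentiable_imp_differentiable
        simp: field_differentiable_within_exp)
  moreover have "exp ` N = {x. 0 < x \<and> ln x \<in> N}"
    by (force simp: image_iff)
  ultimately have "{x. 0 < x \<and> ln x \<in> N} \<in> null_sets (completion lborel)"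
    by (simp add: negligible_iff_null_sets)
  moreover have "{x. 0 < x \<and> ln x \<in> N} \<in> sets lborel"
    by simp
  ultimately show ?thesis
    by (simp add: null_sets_completion_iff)
qed

lemma real_distribution_distr_borel:
  assumes "prob_space M" "f \<in> borel_measurable M"
  shows "real_distribution (distr M borel f)"
  using prob_space.prob_space_distr[OF assms]
  by (simp add: real_distribution_def real_distribution_axioms_def)

section \<open>The maximal ratio and Pareto laws\<close>

context iid_pair
begin

definition max_ratio :: "'a \<Rightarrow> real" where
  "max_ratio w = max (U w / V w) (V w / U w)"

lemma measurable_max_ratio [measurable]: "max_ratio \<in> borel_measurable M"
  unfolding max_ratio_def by measurable

text \<open>For t > 0 one of t and 1/t is at least 1. Positivity matters: division by zero yields 0,
  so the maximum could fall below 1.\<close>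

lemma max_ratio_ge_1:
  assumes "AE w in M. 0 < U w"
  shows "AE w in M. 1 \<le> max_ratio w"
proof -
  have "AE w in M. 0 < V w"
    by (rule AE_V[OF assms]) simp
  with assms show ?thesis
  proof eventually_elim
    case (elim w)
    then show ?case
      by (cases "U w \<le> V w") (auto simp: max_ratio_def le_max_iff_disj)
  qed
qed

lemma pareto_if_max_ratio:
  assumes nonneg: "AE w in M. 0 \<le> U w" and ac: "absolutely_continuous lborel (distr M borel U)"
    and eq: "distr M borel U = distr M borel max_ratio"
  shows "distr M borel U \<in> pareto_family"
proof -
  have "AE w in M. U w \<notin> {0}"
    by (rule AE_notin_null[OF ac]) (simp add: finite_imp_null_set_lborel)
  with nonneg have pos: "AE w in M. 0 < U w"
    by eventually_elim auto
  have pos_V: "AE w in M. 0 < V w"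
    by (rule AE_V[OF pos]) simp
  \<comment> \<open>Through the assumed equality of laws \<open>U\<close> inherits the lower bound 1
    from \<open>max_ratio\<close>, and its logarithm becomes nonnegative.\<close>
  have "AE x in distr M borel U. 1 \<le> x"
    using max_ratio_ge_1[OF pos] unfolding eq by (subst AE_distr_iff) auto
  then have ge1: "AE w in M. 1 \<le> U w"
    by (subst (asm) AE_distr_iff) auto
  interpret L: abs_diff_law M "\<lambda>w. ln (U w)" "\<lambda>w. ln (V w)"
  proof unfold_locales
    show "indep_var borel (\<lambda>w. ln (U w)) borel (\<lambda>w. ln (V w))"
      using indep_var_compose[OF indep, of ln borel ln borel] by (simp add: comp_def)
    have "distr (distr M borel V) borel ln = distr (distr M borel U) borel ln"
      by (simp only: eq_distr)
    then show "distr M borel (\<lambda>w. ln (V w)) = distr M borel (\<lambda>w. ln (U w))"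
      by (simp add: distr_distr comp_def)
    show "AE w in M. 0 \<le> ln (U w)"
      using ge1 by eventually_elim simp
    have "distr (distr M borel U) borel ln = distr (distr M borel max_ratio) borel ln"
      by (simp only: eq)
    then have "distr M borel (\<lambda>w. ln (U w)) = distr M borel (\<lambda>w. ln (max_ratio w))"
      by (simp add: distr_distr comp_def)
    also have "\<dots> = distr M borel (\<lambda>w. \<bar>ln (U w) - ln (V w)\<bar>)"
    proof (rule distr_cong_AE)
      show "AE w in M. ln (max_ratio w) = \<bar>ln (U w) - ln (V w)\<bar>"
        using pos pos_V
      proof eventually_elim
        case (elim w)
        show ?case
        proof (cases "U w \<le> V w")
          case True
          with elim have "U w / V w \<le> 1" "1 \<le> V w / U w" "ln (U w) \<le> ln (V w)"
            by auto
          then have "max_ratio w = V w / U w"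
            unfolding max_ratio_def by linarith
          with \<open>ln (U w) \<le> ln (V w)\<close> show ?thesis
            using elim by (simp add: ln_div)
        next
          case False
          with elim have "V w / U w \<le> 1" "1 \<le> U w / V w" "ln (V w) \<le> ln (U w)"
            by auto
          then have "max_ratio w = U w / V w"
            unfolding max_ratio_def by linarith
          with \<open>ln (V w) \<le> ln (U w)\<close> show ?thesis
            using elim by (simp add: ln_div)
        qed
      qed
    qed simp_all
    finally show "distr M borel (\<lambda>w. \<bar>ln (U w) - ln (V w)\<bar>) = distr M borel (\<lambda>w. ln (U w))"
      by simp
    show "absolutely_continuous lborel (distr M borel (\<lambda>w. ln (U w)))"
      unfolding absolutely_continuous_def
    proof
      fix N :: "real set" assume N: "N \<in> null_sets lborel"
      then have [measurable]: "N \<in> sets borel"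
        by auto
      have "AE w in M. U w \<notin> {x. 0 < x \<and> ln x \<in> N}"
        by (rule AE_notin_null[OF ac ln_vimage_null_set[OF N]])
      with pos have "AE w in M. ln (U w) \<notin> N"
        by eventually_elim auto
      then have "AE x in distr M borel (\<lambda>w. ln (U w)). x \<notin> N"
        by (subst AE_distr_iff) auto
      then show "N \<in> null_sets (distr M borel (\<lambda>w. ln (U w)))"
        by (subst (asm) AE_iff_null_sets[symmetric]) auto
    qed
  qed
  obtain c where c: "0 < c" and exp: "distributed M lborel (\<lambda>w. ln (U w)) (exponential_density c)"
    using L.exponential by blast
  have "cdf (distr M borel U) = pareto_cdf c"
  proof
    fix x
    have cdf: "cdf (distr M borel U) x = prob {w \<in> space M. U w \<le> x}"
      by (auto simp: cdf_def measure_distr vimage_def intro!: arg_cong[where f = prob])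
    show "cdf (distr M borel U) x = pareto_cdf c x"
    proof (cases "1 \<le> x")
      case True
      have "prob {w \<in> space M. U w \<le> x} = prob {w \<in> space M. ln (U w) \<le> ln x}"
      proof (rule measure_eq_AE)
        show "AE w in M. (w \<in> {w \<in> space M. U w \<le> x}) = (w \<in> {w \<in> space M. ln (U w) \<le> ln x})"
          using pos by eventually_elim (use True in auto)
      qed measurable
      also have "\<dots> = 1 - exp (- ln x * c)"
        using True by (intro exponential_distributedD_le[OF exp _ c]) simp
      finally show ?thesis
        using True by (simp add: cdf pareto_cdf_def powr_def mult.commute)
    next
      case False
      have "AE w in M. \<not> U w \<le> x"
        using ge1 by eventually_elim (use False in auto)
      then have "prob {w \<in> space M. U w \<le> x} = 0"
        by (subst prob_eq_0) auto
      then show ?thesis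
        using False by (simp add: cdf pareto_cdf_def)
    qed
  qed
  with c show ?thesis
    by (auto simp: pareto_family_def)
qed

lemma max_ratio_if_pareto:
  assumes ac: "absolutely_continuous lborel (distr M borel U)"
    and a: "0 < a" and cdf: "cdf (distr M borel U) = pareto_cdf a"
  shows "distr M borel U = distr M borel max_ratio"
proof -
  let ?D = "distr M borel U"
  interpret D: real_distribution ?D
    by (rule real_distribution_distr_borel) (auto intro: prob_space_axioms)
  interpret DD: pair_prob_space ?D ?D ..
  have tail: "prob {w \<in> space M. U w > z} = z powr (- a)" if "1 \<le> z" for z
  proof -
    have "prob {w \<in> space M. U w \<le> z} = 1 - z powr (- a)"
      using fun_cong[OF cdf, of z] that
      by (simp add: cdf_def measure_distr vimage_def pareto_cdf_def Int_def conj_commute)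
    then show ?thesis
      using prob_neg[of "\<lambda>w. U w \<le> z"] by (simp add: not_le)
  qed
  have gt1: "AE w in M. 1 < U w"
  proof -
    have "prob {w \<in> space M. U w > 1} = 1"
      using tail[of 1] by simp
    then show ?thesis
      by (subst (asm) prob_Collect_eq_1) auto
  qed
  then have pos: "AE w in M. 0 < U w"
    by eventually_elim simp
  have pos_V: "AE w in M. 0 < V w"
    by (rule AE_V[OF pos]) simp
  have joint: "emeasure M {w \<in> space M. (U w, V w) \<in> A}
      = (\<integral>\<^sup>+y. emeasure ?D {x. (x, y) \<in> A} \<partial>?D)" if A: "A \<in> sets (borel \<Otimes>\<^sub>M borel)" for A
  proof -
    have "emeasure M {w \<in> space M. (U w, V w) \<in> A}
        = emeasure (distr M (borel \<Otimes>\<^sub>M borel) (\<lambda>w. (U w, V w))) A"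
      using A by (subst emeasure_distr) (auto simp: vimage_def Int_def conj_commute)
    also have "\<dots> = (\<integral>\<^sup>+y. emeasure ?D ((\<lambda>x. (x, y)) -` A) \<partial>?D)"
      unfolding joint_distr using A
      by (intro DD.emeasure_pair_measure_alt2) (simp cong: sets_pair_measure_cong)
    finally show ?thesis
      by (simp add: vimage_def)
  qed
  have sets_gt: "{p :: real \<times> real. fst p > z * snd p} \<in> sets (borel \<Otimes>\<^sub>M borel)" for z
    unfolding borel_prod by (intro borel_open open_Collect_less continuous_intros)
  have sets_eq: "{p :: real \<times> real. fst p = snd p} \<in> sets (borel \<Otimes>\<^sub>M borel)"
    unfolding borel_prod by (intro borel_closed closed_Collect_eq continuous_intros)
  \<comment> \<open>Conditioning on \<open>V\<close> and the power-law tail make this the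
    probability of \<open>U w > V w\<close>. Its value 1/2 comes from symmetry and the absence of
    ties, with no integral computed.\<close>
  define I where "I = (\<integral>\<^sup>+y. ennreal (y powr (- a)) \<partial>?D)"
  have gtU: "emeasure M {w \<in> space M. U w > z * V w} = ennreal (z powr (- a)) * I" if z: "1 \<le> z" for z
  proof -
    have "emeasure M {w \<in> space M. U w > z * V w}
        = (\<integral>\<^sup>+y. emeasure ?D {x. x > z * y} \<partial>?D)"
      using joint[OF sets_gt[of z]] by simp
    also have "\<dots> = (\<integral>\<^sup>+y. ennreal (z powr (- a)) * ennreal (y powr (- a)) \<partial>?D)"
    proof (rule nn_integral_cong_AE)
      have "AE y in ?D. 1 < y"
        using gt1 by (subst AE_distr_iff) auto
      then show "AE y in ?D. emeasure ?D {x. x > z * y} = ennreal (z powr (- a)) * ennreal (y powr (- a))"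
      proof eventually_elim
        case (elim y)
        then have zy: "1 \<le> z * y"
          using z mult_mono[of 1 z 1 y] by simp
        have "emeasure ?D {x. x > z * y} = emeasure M {w \<in> space M. U w > z * y}"
          by (subst emeasure_distr) (auto simp: vimage_def Int_def conj_commute)
        also have "\<dots> = ennreal ((z * y) powr (- a))"
          using tail[OF zy] by (simp add: emeasure_eq_measure)
        also have "\<dots> = ennreal (z powr (- a)) * ennreal (y powr (- a))"
          using z elim by (simp add: powr_mult ennreal_mult)
        finally show ?case .
      qed
    qed
    also have "\<dots> = ennreal (z powr (- a)) * I"
      unfolding I_def by (rule nn_integral_cmult) simp
    finally show ?thesis .
  qed
  have gtV: "emeasure M {w \<in> space M. V w > z * U w} = emeasure M {w \<in> space M. U w > z * V w}" for z
  proof -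
    let ?A = "{p :: real \<times> real. fst p > z * snd p}"
    have "emeasure (distr M (borel \<Otimes>\<^sub>M borel) (\<lambda>w. (V w, U w))) ?A
        = emeasure (distr M (borel \<Otimes>\<^sub>M borel) (\<lambda>w. (U w, V w))) ?A"
      by (simp only: distr_swap)
    then show ?thesis
      using sets_gt[of z] by (simp add: emeasure_distr vimage_def Int_def conj_commute)
  qed
  \<comment> \<open>Given \<open>V\<close>, a tie asks \<open>U\<close> to hit a single point, which
    has probability 0 under an absolutely continuous law.\<close>
  have neq: "AE w in M. U w \<noteq> V w"
  proof -
    have "emeasure M {w \<in> space M. U w = V w} = (\<integral>\<^sup>+y. emeasure ?D {x. x = y} \<partial>?D)"
      using joint[OF sets_eq] by simp
    also have "\<dots> = (\<integral>\<^sup>+y. 0 \<partial>?D)"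
    proof (rule nn_integral_cong)
      fix y
      have "{y} \<in> null_sets ?D"
        using ac by (auto simp: absolutely_continuous_def finite_imp_null_set_lborel)
      then show "emeasure ?D {x. x = y} = 0"
        by (simp add: null_setsD1)
    qed
    finally show ?thesis
      by (subst AE_iff_measurable[OF _ refl]) auto
  qed
  have half: "I + I = 1"
  proof -
    have "1 = emeasure M ({w \<in> space M. U w > 1 * V w} \<union> {w \<in> space M. V w > 1 * U w})"
    proof -
      have "AE w in M. w \<in> {w \<in> space M. U w > 1 * V w} \<union> {w \<in> space M. V w > 1 * U w}"
        using neq AE_space by eventually_elim auto
      then show ?thesis
        by (intro emeasure_eq_1_AE[symmetric]) auto
    qed
    also have "\<dots> = emeasure M {w \<in> space M. U w > 1 * V w} + emeasure M {w \<in> space M. V w > 1 * U w}"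
      by (rule plus_emeasure[symmetric]) auto
    also have "\<dots> = I + I"
      using gtU[of 1] gtV[of 1] by simp
    finally show ?thesis ..
  qed
  have "cdf (distr M borel max_ratio) = pareto_cdf a"
  proof
    fix z
    have cdf': "cdf (distr M borel max_ratio) z = prob {w \<in> space M. max_ratio w \<le> z}"
      by (auto simp: cdf_def measure_distr vimage_def intro!: arg_cong[where f = prob])
    show "cdf (distr M borel max_ratio) z = pareto_cdf a z"
    proof (cases "1 \<le> z")
      case True
      have "emeasure M {w \<in> space M. max_ratio w > z}
          = emeasure M ({w \<in> space M. U w > z * V w} \<union> {w \<in> space M. V w > z * U w})"
      proof (rule emeasure_eq_AE)
        show "AE w in M. (w \<in> {w \<in> space M. max_ratio w > z})
            = (w \<in> {w \<in> space M. U w > z * V w} \<union> {w \<in> space M. V w > z * U w})"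
          using pos pos_V
          by eventually_elim (auto simp: max_ratio_def less_max_iff_disj field_simps)
      qed measurable
      also have "\<dots> = emeasure M ({w \<in> space M. U w > z * V w} \<union> ({w \<in> space M. V w > z * U w} - {w \<in> space M. U w > z * V w}))"
        by (rule arg_cong[where f = "emeasure M"]) auto
      also have "\<dots> = emeasure M {w \<in> space M. U w > z * V w}
          + emeasure M ({w \<in> space M. V w > z * U w} - {w \<in> space M. U w > z * V w})"
        by (rule plus_emeasure[symmetric]) auto
      \<comment> \<open>For positive values and \<open>1 \<le> z\<close> the two events exclude each
        other: they would give both \<open>U w > V w\<close> and \<open>V w > U w\<close>.\<close>
      also have "emeasure M ({w \<in> space M. V w > z * U w} - {w \<in> space M. U w > z * V w})
          = emeasure M {w \<in> space M. V w > z * U w}"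
      proof (rule emeasure_eq_AE)
        show "AE w in M. (w \<in> {w \<in> space M. V w > z * U w} - {w \<in> space M. U w > z * V w})
            = (w \<in> {w \<in> space M. V w > z * U w})"
          using pos pos_V
        proof eventually_elim
          case (elim w)
          have "U w \<le> z * U w" "V w \<le> z * V w"
            using elim True by (simp_all add: mult_le_cancel_right1)
          then show ?case by auto
        qed
      qed measurable
      also have "emeasure M {w \<in> space M. U w > z * V w} + emeasure M {w \<in> space M. V w > z * U w}
          = ennreal (z powr (- a)) * (I + I)"
        using True by (simp add: gtU gtV distrib_left)
      also have "\<dots> = ennreal (z powr (- a))"
        by (simp only: half mult_1_right)
      finally have "prob {w \<in> space M. max_ratio w > z} = z powr (- a)"
        by (simp add: emeasure_eq_measure)
      then have "prob {w \<in> space M. max_ratio w \<le> z} = 1 - z powr (- a)"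
        using prob_neg[of "\<lambda>w. max_ratio w > z"] by (simp add: not_less)
      then show ?thesis
        using True by (simp add: cdf' pareto_cdf_def)
    next
      case False
      have "AE w in M. \<not> max_ratio w \<le> z"
        using max_ratio_ge_1[OF pos] by eventually_elim (use False in auto)
      then have "prob {w \<in> space M. max_ratio w \<le> z} = 0"
        by (subst prob_eq_0) auto
      then show ?thesis
        using False by (simp add: cdf' pareto_cdf_def)
    qed
  qed
  then show ?thesis
    by (intro cdf_unique real_distribution_distr_borel prob_space_axioms) (simp_all add: cdf)
qed

end

theorem theorem1:
  fixes M :: "'a measure" and X Y :: "'a \<Rightarrow> real"
  assumes "prob_space M"
    and "X \<in> borel_measurable M" and "Y \<in> borel_measurable M"
    and "prob_space.indep_var M borel X borel Y"
    and "distr M borel X = distr M borel Y"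
    and "AE \<omega> in M. 0 \<le> X \<omega>" and "AE \<omega> in M. 0 \<le> Y \<omega>"
    and "absolutely_continuous lborel (distr M borel X)"
    and "absolutely_continuous lborel (distr M borel Y)"
  shows "distr M borel X = distr M borel (\<lambda>\<omega>. max (X \<omega> / Y \<omega>) (Y \<omega> / X \<omega>))
         \<longleftrightarrow> distr M borel X \<in> pareto_family"
proof -
  interpret prob_space M by fact
  interpret iid_pair M X Y
    by unfold_locales (use assms in simp_all)
  have "distr M borel (\<lambda>\<omega>. max (X \<omega> / Y \<omega>) (Y \<omega> / X \<omega>)) = distr M borel max_ratio"
    by (simp add: max_ratio_def[abs_def])
  then show ?thesis
    using pareto_if_max_ratio max_ratio_if_pareto assms by (auto simp: pareto_family_def)
qed

end
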